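(* Let $G$ be a graph of treewidth $t$ and let $\mathcal H,\mathcal K$ be two non-piercing families of subgraphs of $G$. Then $(G,\mathcal H,\mathcal K)$ admits an intersection support $\tilde Q$ with $\mathrm{tw}(\tilde Q)\le 2^{2^{t+4}+4(t+1)}$.
   Context: All graphs are finite and simple. A subgraph $H$ of a graph $G$ is identified with its vertex set $V(H)$ (subgraphs are taken to be induced), and intersections, differences and containments of subgraphs refer to their vertex sets. A family $\mathcal H$ of subgraphs of $G$ is non-piercing if every $H\in\mathcal H$ induces a connected subgraph of $G$ and, for all $H,H'\in\mathcal H$, the induced subgraph $G[V(H)\setminus V(H')]$ is connected (an empty vertex set is regarded as connected). For families $\mathcal H,\mathcal K$ of subgraphs of $G$ and $K\in\mathcal K$, let $\mathcal H_K=\{H\in\mathcal H: V(H)\cap V(K)\ne\emptyset\}$. An intersection support for $(G,\mathcal H,\mathcal K)$ is a graph $\tilde Q$ with vertex set $\mathcal H$ such that $\tilde Q[\mathcal H_K]$ is connected for every $K\in\mathcal K$. $\mathrm{tw}$ denotes treewidth. *)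

theory Defs
  imports Main
begin

definition graph :: "'v set \<Rightarrow> 'v set set \<Rightarrow> bool" where
  "graph V E \<longleftrightarrow> finite V \<and> (\<forall>e\<in>E. \<exists>u v. u \<noteq> v \<and> u \<in> V \<and> v \<in> V \<and> e = {u, v})"

text \<open>The subgraph induced by S is connected (empty S counts as connected).\<close>
definition connected_set :: "'v set set \<Rightarrow> 'v set \<Rightarrow> bool" where
  "connected_set E S \<longleftrightarrow>
     (\<forall>u\<in>S. \<forall>v\<in>S. (\<lambda>x y. x \<in> S \<and> y \<in> S \<and> {x, y} \<in> E)\<^sup>*\<^sup>* u v)"

definition is_tree :: "'i set \<Rightarrow> 'i set set \<Rightarrow> bool" where
  "is_tree I F \<longleftrightarrow> graph I F \<and> I \<noteq> {} \<and> connected_set F I \<and> card F + 1 = card I"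

definition tree_decomposition ::
  "'v set \<Rightarrow> 'v set set \<Rightarrow> nat set \<Rightarrow> nat set set \<Rightarrow> (nat \<Rightarrow> 'v set) \<Rightarrow> bool" where
  "tree_decomposition V E I F B \<longleftrightarrow>
     is_tree I F \<and>
     (\<forall>i\<in>I. B i \<subseteq> V) \<and>
     (\<forall>v\<in>V. \<exists>i\<in>I. v \<in> B i) \<and>
     (\<forall>e\<in>E. \<exists>i\<in>I. e \<subseteq> B i) \<and>
     (\<forall>v\<in>V. connected_set F {i\<in>I. v \<in> B i})"

text \<open>Treewidth: least k such that there is a tree decomposition with all bags of size \<le> k+1
  (for the empty graph this yields 0 rather than -1).\<close>
definition treewidth :: "'v set \<Rightarrow> 'v set set \<Rightarrow> nat" where
  "treewidth V E = (LEAST k. \<exists>I F B. tree_decomposition V E I F B \<and> (\<forall>i\<in>I. card (B i) \<le> k + 1))"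

text \<open>Non-piercing family of (vertex sets of induced) subgraphs.\<close>
definition non_piercing :: "'v set \<Rightarrow> 'v set set \<Rightarrow> 'v set set \<Rightarrow> bool" where
  "non_piercing V E \<H> \<longleftrightarrow>
     (\<forall>H\<in>\<H>. H \<subseteq> V \<and> connected_set E H) \<and>
     (\<forall>H\<in>\<H>. \<forall>H'\<in>\<H>. connected_set E (H - H'))"

definition intersection_support :: "'v set set \<Rightarrow> 'v set set \<Rightarrow> 'v set set set \<Rightarrow> bool" where
  "intersection_support \<H> \<K> Q \<longleftrightarrow>
     graph \<H> Q \<and> (\<forall>K\<in>\<K>. connected_set Q {H\<in>\<H>. H \<inter> K \<noteq> {}})"

end

theory Submission
  imports Defs
begin

text \<open>Take a tree decomposition of G of width t. If two members of a non-piercing family have the same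
  trace on a bag, then their difference is connected and avoids the bag, so it lies on one side of it.
  This is used twice.

  First the bags are enlarged, by at most two vertices for every trace, until for every K the nodes
  whose bags contain a common vertex of K and some H form a subtree.

  Then the nodes are visited from the root downwards. At each node one representative is kept active
  for every trace of the sets H, and any other H remains active only on the side on which it
  leaves its representative; elsewhere H is contained in the representative. The active sets at
  adjacent nodes, at most one per trace and node, form the bags of a tree decomposition. The sets that
  are active nowhere are covered by the active sets of a single bag and become leaves. Joining all
  pairs in a common bag gives the support.\<close>

section \<open>Connected vertex sets\<close>

abbreviation walk :: "'v set set \<Rightarrow> 'v set \<Rightarrow> 'v \<Rightarrow> 'v \<Rightarrow> bool" where
  "walk E S \<equiv> (\<lambda>x y. x \<in> S \<and> y \<in> S \<and> {x, y} \<in> E)\<^sup>*\<^sup>*"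

lemma walk_sym: "walk E S u v \<Longrightarrow> walk E S v u"
  by (rule sympD[OF symp_rtranclp]) (auto intro!: sympI simp: insert_commute)

lemma connected_set_crossing:
  assumes "connected_set E S" "a \<in> S \<inter> A" "b \<in> S - A"
  obtains u v where "u \<in> S \<inter> A" "v \<in> S - A" "{u, v} \<in> E"
proof -
  have "walk E S a b" using assms by (auto simp: connected_set_def)
  then have "b \<in> A \<or> (\<exists>u\<in>S \<inter> A. \<exists>v\<in>S - A. {u, v} \<in> E)"
    by induction (use assms in auto)
  then show thesis using assms that by blast
qed

section \<open>Rooted trees\<close>

locale rooted_tree =
  fixes par :: "nat \<Rightarrow> nat"
  assumes par_0 [simp]: "par 0 = 0"
    and par_less: "0 < k \<Longrightarrow> par k < k"
begin

lemma par_le: "par k \<le> k"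
  using par_less[of k] by (cases "k = 0") auto

definition desc :: "nat \<Rightarrow> nat set" where
  "desc k = {j. \<exists>i. (par ^^ i) j = k}"

text \<open>Parents have smaller numbers, so this is connectedness in the tree: only the least node of N
  may have its parent outside N.\<close>
definition subtree :: "nat set \<Rightarrow> bool" where
  "subtree N \<longleftrightarrow> (\<forall>j\<in>N. \<forall>k\<in>N. j < k \<longrightarrow> par k \<in> N)"

definition adjacent :: "nat \<Rightarrow> nat \<Rightarrow> bool" where
  "adjacent x y \<longleftrightarrow> x \<noteq> y \<and> (par x = y \<or> par y = x)"

text \<open>For adjacent nodes, the component of y after the edge between x and y is removed.\<close>
definition side :: "nat \<Rightarrow> nat \<Rightarrow> nat set" where
  "side x y = (if par y = x then desc y else - desc x)"

definition hull :: "nat \<Rightarrow> nat \<Rightarrow> nat set" where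
  "hull i j = \<Inter>{M. subtree M \<and> i \<in> M \<and> j \<in> M}"

lemma desc_self [simp]: "k \<in> desc k"
  unfolding desc_def by (auto intro: exI[of _ 0])

lemma desc_ge: "j \<in> desc k \<Longrightarrow> k \<le> j"
proof -
  have "(par ^^ i) j \<le> j" for i
    by (induction i) (auto intro: order_trans[OF par_le])
  then show "j \<in> desc k \<Longrightarrow> k \<le> j" by (auto simp: desc_def)
qed

lemma par_in_desc: "j \<in> desc k \<Longrightarrow> j \<noteq> k \<Longrightarrow> par j \<in> desc k"
  unfolding desc_def
proof clarify
  fix i assume "j \<noteq> (par ^^ i) j"
  then obtain i' where "i = Suc i'" by (cases i) auto
  then show "\<exists>i''. (par ^^ i'') (par j) = (par ^^ i) j"
    by (auto simp: funpow_Suc_right simp del: funpow.simps)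
qed

lemma in_desc_if_par: "par j \<in> desc k \<Longrightarrow> j \<in> desc k"
  unfolding desc_def
  by (auto simp: funpow_Suc_right simp del: funpow.simps intro: exI[of _ "Suc _"])

lemma desc_0 [simp]: "j \<in> desc 0"
proof (induction j rule: less_induct)
  case (less j)
  then show ?case using in_desc_if_par par_less by (cases "j = 0") auto
qed

lemma desc_child:
  "q \<in> desc k \<Longrightarrow> q \<noteq> k \<Longrightarrow> \<exists>c. par c = k \<and> k < c \<and> q \<in> desc c"
proof (induction q rule: less_induct)
  case (less q)
  have "k < q" using desc_ge[OF less.prems(1)] less.prems(2) by simp
  show ?case
  proof (cases "par q = k")
    case True
    then show ?thesis using \<open>k < q\<close> desc_self by blast
  next
    case False
    have "par q < q" using \<open>k < q\<close> par_less by simp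
    then show ?thesis using less.IH[OF _ par_in_desc[OF less.prems] False] in_desc_if_par by blast
  qed
qed

lemma subtreeD: "subtree N \<Longrightarrow> j \<in> N \<Longrightarrow> k \<in> N \<Longrightarrow> j < k \<Longrightarrow> par k \<in> N"
  by (auto simp: subtree_def)

lemma subtree_empty [simp]: "subtree {}"
  and subtree_singleton [simp]: "subtree {i}"
  by (simp_all add: subtree_def)

lemma subtree_lessThan: "subtree {..<n}"
  unfolding subtree_def using par_le by (auto intro: le_less_trans)

lemma subtree_Int: "subtree M \<Longrightarrow> subtree N \<Longrightarrow> subtree (M \<inter> N)"
  by (auto simp: subtree_def)

lemma subtree_adjacent: "adjacent x y \<Longrightarrow> subtree {x, y}"
  using par_le[of x] par_le[of y] by (auto simp: subtree_def adjacent_def)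

lemma subtree_desc: "subtree (desc k)"
  unfolding subtree_def by (metis desc_ge par_in_desc leD)

lemma subtree_Compl_desc: "subtree (- desc k)"
  unfolding subtree_def using in_desc_if_par by blast

lemma subtree_with_children:
  assumes "subtree N"
  shows "subtree {x. x \<in> N \<or> par x \<in> N}"
proof -
  have "par k \<in> N" if "j \<in> N \<or> par j \<in> N" "k \<in> N" "j < k" for j k
    using that subtreeD[OF assms, of j k] subtreeD[OF assms, of "par j" k] par_le[of j] by auto
  then show ?thesis by (auto simp: subtree_def)
qed

lemma subtree_crossing_desc:
  assumes N: "subtree N"
  shows "a \<in> N \<Longrightarrow> a \<in> desc k \<Longrightarrow> b \<in> N \<Longrightarrow> b \<notin> desc k \<Longrightarrow> k \<in> N \<and> par k \<in> N"
proof (induction "a + b" arbitrary: a b rule: less_induct)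
  case less
  have "a \<noteq> b" using less.prems by auto
  then consider "b < a" "a = k" | "b < a" "a \<noteq> k" | "a < b" by linarith
  then show ?case
  proof cases
    case 1
    then show ?thesis using subtreeD[OF N] less.prems by blast
  next
    case 2
    moreover have "par a \<in> N" using subtreeD[OF N] 2 less.prems by blast
    ultimately show ?thesis
      using less.hyps[of "par a" b] less.prems par_in_desc par_less[of a] by auto
  next
    case 3
    moreover have "par b \<in> N" using subtreeD[OF N] 3 less.prems by blast
    moreover have "par b \<notin> desc k" using in_desc_if_par less.prems by blast
    ultimately show ?thesis
      using less.hyps[of a "par b"] less.prems par_less[of b] by auto
  qed
qed

lemma subtree_Un:
  assumes "subtree M" "subtree N" "c \<in> M" "c \<in> N"
  shows "subtree (M \<union> N)"
proof -
  have par_in_Un: "par k \<in> M \<union> N"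
    if M: "subtree M" and N: "subtree N" and c: "c \<in> M" "c \<in> N"
      and j: "j \<in> M" and k: "k \<in> N" and less: "j < k" for M N j k
  proof (cases "c \<in> desc k")
    case True
    have "j \<notin> desc k" using desc_ge less by (meson leD)
    then show ?thesis using subtree_crossing_desc[OF M c(1) True j] by blast
  next
    case False
    then show ?thesis using subtree_crossing_desc[OF N k desc_self c(2)] by blast
  qed
  show ?thesis
    unfolding subtree_def
    using par_in_Un[OF assms] par_in_Un[OF assms(2,1,4,3)] subtreeD[OF assms(1)] subtreeD[OF assms(2)]
    by blast
qed

lemma adjacent_sym: "adjacent x y \<Longrightarrow> adjacent y x"
  by (auto simp: adjacent_def)

lemma adjacent_par: "0 < k \<Longrightarrow> adjacent k (par k)"
  using par_less[of k] by (auto simp: adjacent_def)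

lemma adjacent_less: "adjacent x y \<Longrightarrow> y < x \<Longrightarrow> y = par x"
  using par_le[of y] by (auto simp: adjacent_def)

lemma side_commute: "adjacent x y \<Longrightarrow> side y x = - side x y"
  using par_le[of x] par_le[of y] by (auto simp: adjacent_def side_def)

lemma side_par: "0 < k \<Longrightarrow> side k (par k) = - desc k"
  using par_less[of k] par_le[of "par k"] by (auto simp: side_def)

lemma side_ends:
  assumes "adjacent x y"
  shows "y \<in> side x y" "x \<notin> side x y"
proof -
  have "v \<in> side u v" if "adjacent u v" for u v
    using that par_le[of u] desc_ge[of v u] by (auto simp: adjacent_def side_def)
  then show "y \<in> side x y" "x \<notin> side x y"
    using assms adjacent_sym side_commute by blast+
qed

lemma subtree_side: "subtree (side x y)"
  using subtree_desc subtree_Compl_desc by (simp add: side_def)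

lemma subtree_crossing:
  assumes "subtree N" "adjacent x y" "a \<in> N" "a \<in> side x y" "b \<in> N" "b \<notin> side x y"
  shows "x \<in> N" "y \<in> N"
proof -
  have "x \<in> N \<and> y \<in> N"
  proof (cases "par y = x")
    case True
    then show ?thesis using subtree_crossing_desc[of N a y b] assms by (simp add: side_def)
  next
    case False
    then show ?thesis using subtree_crossing_desc[of N b x a] assms by (simp add: side_def adjacent_def)
  qed
  then show "x \<in> N" "y \<in> N" by simp_all
qed

lemma adjacent_towards:
  assumes "p \<noteq> x"
  obtains y where "adjacent x y" "p \<in> side x y"
proof (cases "p \<in> desc x")
  case True
  then obtain c where "par c = x" "x < c" "p \<in> desc c" using desc_child assms by blast
  then show thesis using that[of c] by (simp add: adjacent_def side_def)
next
  case False
  then have "0 < x" by (cases x) auto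
  then show thesis using that[OF adjacent_par] False by (simp add: side_par)
qed

lemma subtree_within_side:
  assumes "subtree N" "x \<notin> N"
  obtains y where "adjacent x y" "N \<subseteq> side x y"
proof (cases "N = {}")
  case True
  then show thesis using adjacent_towards[of "Suc x" x] that by auto
next
  case False
  then obtain p where "p \<in> N" by blast
  then have "p \<noteq> x" using assms by blast
  then obtain y where "adjacent x y" "p \<in> side x y" by (rule adjacent_towards)
  then show thesis using that subtree_crossing[OF assms(1)] assms(2) \<open>p \<in> N\<close> by blast
qed

lemma subtree_hull: "subtree (hull i j)"
  unfolding hull_def subtree_def by blast

lemma hull_least: "subtree M \<Longrightarrow> i \<in> M \<Longrightarrow> j \<in> M \<Longrightarrow> hull i j \<subseteq> M"
  unfolding hull_def by blast

lemma hull_ends [simp]: "i \<in> hull i j" "j \<in> hull i j"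
  unfolding hull_def by auto

lemma hull_commute: "hull i j = hull j i"
  unfolding hull_def by (rule arg_cong[where f = Inter]) auto

lemma hull_self [simp]: "hull i i = {i}"
  using hull_least[of "{i}" i i] by auto

lemma finite_hull: "finite (hull i j)"
  by (rule finite_subset[OF hull_least[OF subtree_lessThan[of "Suc (max i j)"]]]) auto

lemma hull_triangle: "hull i j \<subseteq> hull i w \<union> hull w j"
  by (intro hull_least subtree_Un[where c = w] subtree_hull) auto

lemma subtree_hull_Diff_end: "subtree (hull i j - {j})"
proof (cases "i = j")
  case False
  then obtain y where y: "adjacent j y" "i \<in> side j y" using adjacent_towards by blast
  have "subtree (side j y \<union> {j, y})"
    using y side_ends by (intro subtree_Un[where c = y] subtree_side subtree_adjacent) auto
  then have "hull i j \<subseteq> side j y \<union> {j, y}" using y by (intro hull_least) auto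
  then have "hull i j - {j} = hull i j \<inter> side j y" using y side_ends by blast
  then show ?thesis by (simp add: subtree_Int subtree_hull subtree_side)
qed simp

lemma hull_psubset:
  assumes "w \<in> hull i j" "w \<noteq> j"
  shows "hull i w \<subset> hull i j"
proof -
  have "i \<noteq> j" using assms by auto
  then have "hull i w \<subseteq> hull i j - {j}" using assms by (intro hull_least subtree_hull_Diff_end) auto
  then show ?thesis using hull_ends by blast
qed

lemma card_hull_step:
  assumes "adjacent x y" "p \<in> side x y"
  shows "card (hull y p) < card (hull x p)"
proof -
  have "y \<in> hull x p"
    using subtree_crossing(2)[OF subtree_hull assms(1) hull_ends(2) assms(2) hull_ends(1)]
      side_ends[OF assms(1)] by blast
  then have "hull y p \<subseteq> hull x p \<inter> side x y"
    using assms side_ends by (intro hull_least subtree_Int subtree_hull subtree_side) auto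
  then have "hull y p \<subset> hull x p" using side_ends(2)[OF assms(1)] hull_ends(1)[of x p] by blast
  then show ?thesis by (intro psubset_card_mono finite_hull)
qed

lemma exit_edge:
  assumes "j \<in> N" "p \<notin> N"
  obtains x y where "x \<in> N" "y \<notin> N" "adjacent x y" "p \<in> side x y" "card (hull y p) < card (hull j p)"
proof -
  obtain x where x: "x \<in> N" and least: "\<And>z. z \<in> N \<Longrightarrow> card (hull x p) \<le> card (hull z p)"
    using ex_has_least_nat[of "\<lambda>x. x \<in> N" j "\<lambda>x. card (hull x p)"] assms by blast
  then have "p \<noteq> x" using assms by blast
  then obtain y where y: "adjacent x y" "p \<in> side x y" by (rule adjacent_towards)
  then have closer: "card (hull y p) < card (hull x p)" by (rule card_hull_step)
  then have "y \<notin> N" using least leD by blast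
  moreover have "card (hull y p) < card (hull j p)" using closer least[OF assms(1)] by simp
  ultimately show thesis using that x y by blast
qed

lemma subtree_induct:
  assumes N: "subtree N" "s \<in> N" "p \<in> N" and start: "P s"
    and step: "\<And>x y. x \<in> N \<Longrightarrow> y \<in> N \<Longrightarrow> adjacent x y \<Longrightarrow> P x \<Longrightarrow> P y"
  shows "P p"
proof (rule ccontr)
  assume "\<not> P p"
  then have "s \<in> {x \<in> N. P x}" "p \<notin> {x \<in> N. P x}" using N start by auto
  then obtain x y where xy: "x \<in> N" "P x" "y \<notin> N \<or> \<not> P y" "adjacent x y" "p \<in> side x y"
    by (rule exit_edge) blast
  then have "y \<in> N"
    using subtree_crossing(2)[OF N(1) xy(4) N(3) xy(5) xy(1)] side_ends[OF xy(4)] by blast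
  then show False using step xy by blast
qed

lemma subtree_gap:
  assumes "\<not> subtree N"
  obtains i j where "i \<in> N" "j \<in> N" "hull i j \<inter> N = {i, j}" "hull i j \<noteq> {i, j}"
proof -
  define gaps where "gaps = {(i, j). i \<in> N \<and> j \<in> N \<and> \<not> hull i j \<subseteq> N}"
  obtain j k where "j \<in> N" "k \<in> N" "j < k" "par k \<notin> N"
    using assms by (auto simp: subtree_def)
  then have "(j, k) \<in> gaps"
    unfolding gaps_def using subtreeD[OF subtree_hull, of j j k k] by auto
  then obtain i j where ij: "(i, j) \<in> gaps"
    and least: "\<And>x y. (x, y) \<in> gaps \<Longrightarrow> card (hull i j) \<le> card (hull x y)"
    using ex_has_least_nat[of "\<lambda>p. p \<in> gaps" "(j, k)" "\<lambda>(i, j). card (hull i j)"] by auto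
  have shorter: "hull x y \<subseteq> N" if "x \<in> N" "y \<in> N" "hull x y \<subset> hull i j" for x y
    using least[of x y] that psubset_card_mono[OF finite_hull that(3)] by (auto simp: gaps_def)
  have "w = i \<or> w = j" if w: "w \<in> hull i j" "w \<in> N" for w
  proof (rule ccontr)
    assume "\<not> (w = i \<or> w = j)"
    then have "hull i w \<subset> hull i j" "hull w j \<subset> hull i j"
      using w hull_psubset[of w i j] hull_psubset[of w j i] by (auto simp: hull_commute)
    then have "hull i w \<subseteq> N" "hull w j \<subseteq> N" using shorter w ij by (auto simp: gaps_def)
    then show False using hull_triangle[of i j w] ij by (auto simp: gaps_def)
  qed
  then have "hull i j \<inter> N = {i, j}" using ij by (auto simp: gaps_def)
  moreover have "hull i j \<noteq> {i, j}" using ij by (auto simp: gaps_def)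
  ultimately show thesis using that ij by (auto simp: gaps_def)
qed

definition parent_edges :: "nat \<Rightarrow> nat set set" where
  "parent_edges n = (\<lambda>k. {k, par k}) ` {0<..<n}"

lemma inj_on_parent_edge: "inj_on (\<lambda>k. {k, par k}) {0<..<n}"
proof (rule inj_onI)
  fix x y assume "x \<in> {0<..<n}" "y \<in> {0<..<n}" "{x, par x} = {y, par y}"
  then show "x = y" using par_less[of x] par_less[of y] by (auto simp: doubleton_eq_iff)
qed

lemma adjacent_parent_edge:
  assumes "adjacent x y" "x < n" "y < n"
  shows "{x, y} \<in> parent_edges n"
proof -
  have "{k, par k} \<in> parent_edges n" if "k < n" "par k \<noteq> k" for k
    using that unfolding parent_edges_def by (cases "k = 0") auto
  then show ?thesis using assms unfolding adjacent_def by (metis insert_commute)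
qed

lemma connected_set_parent_edges:
  assumes N: "subtree N" "N \<subseteq> {..<n}"
  shows "connected_set (parent_edges n) N"
  unfolding connected_set_def
proof (intro ballI)
  fix u v assume uv: "u \<in> N" "v \<in> N"
  show "walk (parent_edges n) N u v"
  proof (rule subtree_induct[OF N(1) uv])
    fix x y assume "x \<in> N" "y \<in> N" "adjacent x y" and "walk (parent_edges n) N u x"
    then show "walk (parent_edges n) N u y"
      using N(2) adjacent_parent_edge[of x y n] by (auto intro: rtranclp.rtrancl_into_rtrancl)
  qed simp
qed

lemma is_tree_parent_edges:
  assumes "0 < n"
  shows "is_tree {..<n} (parent_edges n)"
proof -
  have "graph {..<n} (parent_edges n)"
    unfolding graph_def
  proof (intro conjI ballI)
    fix e assume "e \<in> parent_edges n"
    then obtain k where k: "0 < k" "k < n" "e = {k, par k}" by (auto simp: parent_edges_def)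
    then show "\<exists>u v. u \<noteq> v \<and> u \<in> {..<n} \<and> v \<in> {..<n} \<and> e = {u, v}"
      using par_less[of k] by (intro exI[of _ k] exI[of _ "par k"]) auto
  qed simp
  moreover have "card (parent_edges n) + 1 = card {..<n}"
    using assms by (simp add: parent_edges_def card_image[OF inj_on_parent_edge])
  ultimately show ?thesis
    using assms connected_set_parent_edges[OF subtree_lessThan]
    by (simp add: is_tree_def lessThan_empty_iff)
qed

lemma subtree_add_leaf:
  assumes leaf: "rooted_tree (par(n := i))" and N: "subtree N" "N \<subseteq> {..<n}"
  shows "rooted_tree.subtree (par(n := i)) N"
    and "i \<in> N \<Longrightarrow> rooted_tree.subtree (par(n := i)) (insert n N)"
proof -
  interpret leaf: rooted_tree "par(n := i)" by (rule leaf)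
  have less: "k < n" if "k \<in> N" for k using that N by auto
  have step: "(par(n := i)) k \<in> N" if "j \<in> N" "k \<in> N" "j < k" for j k
    using subtreeD[OF N(1) that] less[OF that(2)] by simp
  then show "leaf.subtree N" unfolding leaf.subtree_def by blast
  show "leaf.subtree (insert n N)" if "i \<in> N"
    unfolding leaf.subtree_def
  proof (intro ballI impI)
    fix j k assume jk: "j \<in> insert n N" "k \<in> insert n N" "j < k"
    show "(par(n := i)) k \<in> insert n N"
    proof (cases "k = n")
      case False
      then have "k \<in> N" using jk by blast
      moreover have "j \<in> N" using jk less[OF calculation] by auto
      ultimately show ?thesis using step jk(3) by blast
    qed (use that in simp)
  qed
qed

end

section \<open>Rooted tree decompositions\<close>

definition occ :: "nat \<Rightarrow> (nat \<Rightarrow> 'v set) \<Rightarrow> 'v set \<Rightarrow> nat set" where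
  "occ n B D = {k. k < n \<and> D \<inter> B k \<noteq> {}}"

lemma occ_iff: "k \<in> occ n B D \<longleftrightarrow> k < n \<and> (\<exists>v\<in>D. v \<in> B k)"
  by (auto simp: occ_def)

lemma occ_lessThan: "occ n B D \<subseteq> {..<n}"
  by (auto simp: occ_def)

definition leaf_edges :: "(nat \<Rightarrow> 'v set) \<Rightarrow> ('v \<Rightarrow> nat) \<Rightarrow> 'v set \<Rightarrow> 'v set set" where
  "leaf_edges B host L = {{x, y} | x y. x \<in> L \<and> y \<in> B (host x)}"

lemma leaf_edges_empty [simp]: "leaf_edges B host {} = {}"
  and leaf_edges_insert: "leaf_edges B host (insert x L) =
    leaf_edges B host L \<union> {{x, y} | y. y \<in> B (host x)}"
  by (auto simp: leaf_edges_def)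

locale rooted_decomposition = rooted_tree par for par +
  fixes n :: nat and B :: "nat \<Rightarrow> 'v set" and V :: "'v set" and E :: "'v set set"
  assumes nodes_nonempty: "0 < n"
    and bag_subset: "k < n \<Longrightarrow> B k \<subseteq> V"
    and vertex_in_bag: "v \<in> V \<Longrightarrow> \<exists>k<n. v \<in> B k"
    and edge_in_bag: "e \<in> E \<Longrightarrow> \<exists>k<n. e \<subseteq> B k"
    and subtree_occ_vertex: "v \<in> V \<Longrightarrow> subtree (occ n B {v})"
begin

lemma subtree_occ:
  assumes D: "D \<subseteq> V" "connected_set E D"
  shows "subtree (occ n B D)"
  unfolding subtree_def
proof (intro ballI impI, rule ccontr)
  fix j k assume jk: "j \<in> occ n B D" "k \<in> occ n B D" "j < k" and par: "par k \<notin> occ n B D"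
  have one_side: "occ n B {v} \<subseteq> desc k"
    if v: "v \<in> D" and q: "q \<in> occ n B {v}" "q \<in> desc k" for v q
  proof (rule ccontr)
    assume "\<not> occ n B {v} \<subseteq> desc k"
    then have "par k \<in> occ n B {v}"
      using subtree_crossing_desc[OF subtree_occ_vertex q] v D by blast
    then show False using par v by (auto simp: occ_iff)
  qed
  obtain a b where a: "a \<in> D" "k \<in> occ n B {a}" and b: "b \<in> D" "j \<in> occ n B {b}"
    using jk by (auto simp: occ_iff)
  have "j \<notin> desc k" using desc_ge jk(3) leD by blast
  define inside where "inside = {v. occ n B {v} \<subseteq> desc k}"
  have "a \<in> D \<inter> inside" using one_side[OF a desc_self] a by (simp add: inside_def)
  moreover have "b \<in> D - inside" using b \<open>j \<notin> desc k\<close> by (auto simp: inside_def)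
  ultimately obtain u v where u: "u \<in> D \<inter> inside" and v: "v \<in> D - inside" and uv: "{u, v} \<in> E"
    by (rule connected_set_crossing[OF D(2)])
  obtain q where "q < n" "{u, v} \<subseteq> B q" using edge_in_bag uv by blast
  then have "q \<in> occ n B {u}" "q \<in> occ n B {v}" by (auto simp: occ_iff)
  then show False using one_side[of v q] u v by (auto simp: inside_def)
qed

lemma treewidth_le:
  assumes "\<And>k. k < n \<Longrightarrow> card (B k) \<le> w + 1"
  shows "treewidth V E \<le> w"
proof -
  have "connected_set (parent_edges n) {k \<in> {..<n}. v \<in> B k}" if "v \<in> V" for v
  proof -
    have "{k \<in> {..<n}. v \<in> B k} = occ n B {v}" by (auto simp: occ_def)
    then show ?thesis
      using connected_set_parent_edges[OF subtree_occ_vertex[OF that] occ_lessThan] by simp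
  qed
  then have "tree_decomposition V E {..<n} (parent_edges n) B"
    using is_tree_parent_edges[OF nodes_nonempty] bag_subset vertex_in_bag edge_in_bag
    unfolding tree_decomposition_def by (simp add: Bex_def)
  then show ?thesis
    unfolding treewidth_def by (intro Least_le) (use assms in auto)
qed

lemma subtree_occ_add_leaf:
  assumes leaf: "rooted_tree (par(n := i))" and i: "i < n" and x: "x \<notin> V" and v: "v \<in> insert x V"
  shows "rooted_tree.subtree (par(n := i)) (occ (Suc n) (B(n := insert x (B i))) {v})"
proof -
  let ?B = "B(n := insert x (B i))"
  interpret leaf: rooted_tree "par(n := i)" by (rule leaf)
  show ?thesis
  proof (cases "v = x")
    case True
    then have "occ (Suc n) ?B {v} = {n}" using i x bag_subset by (auto simp: occ_def less_Suc_eq)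
    then show ?thesis by simp
  next
    case False
    then have occ: "occ (Suc n) ?B {v} = (if v \<in> B i then insert n (occ n B {v}) else occ n B {v})"
      by (auto simp: occ_def less_Suc_eq)
    have "subtree (occ n B {v})" using subtree_occ_vertex v False by blast
    note add_leaf = subtree_add_leaf[OF leaf this occ_lessThan]
    show ?thesis
    proof (cases "v \<in> B i")
      case True
      then have "i \<in> occ n B {v}" using i by (simp add: occ_def)
      then show ?thesis using add_leaf(2) True occ by simp
    qed (use add_leaf(1) occ in simp)
  qed
qed

lemma rooted_decomposition_add_leaf:
  assumes "i < n" "x \<notin> V"
  shows "rooted_decomposition (par(n := i)) (Suc n) (B(n := insert x (B i)))
    (insert x V) (E \<union> {{x, y} | y. y \<in> B i})"
proof -
  let ?B = "B(n := insert x (B i))"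
  interpret leaf: rooted_tree "par(n := i)"
    using nodes_nonempty assms par_less by unfold_locales auto
  have new: "\<exists>k<Suc n. D \<subseteq> ?B k" if "D \<subseteq> insert x (B i)" for D
    using that by (intro exI[of _ n]) simp
  have old: "\<exists>k<Suc n. D \<subseteq> ?B k" if "k < n" "D \<subseteq> B k" for k D
    using that by (intro exI[of _ k]) simp
  show ?thesis
  proof
    show "?B k \<subseteq> insert x V" if "k < Suc n" for k
      using that bag_subset[of k] bag_subset[OF assms(1)] by (cases "k = n") auto
  next
    fix v assume "v \<in> insert x V"
    then have "{v} \<subseteq> insert x (B i) \<or> (\<exists>k<n. {v} \<subseteq> B k)" using vertex_in_bag by auto
    then have "\<exists>k<Suc n. {v} \<subseteq> ?B k" using new old by blast
    then show "\<exists>k<Suc n. v \<in> ?B k" by simp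
  next
    fix e assume "e \<in> E \<union> {{x, y} | y. y \<in> B i}"
    then have "e \<subseteq> insert x (B i) \<or> (\<exists>k<n. e \<subseteq> B k)" using edge_in_bag by auto
    then show "\<exists>k<Suc n. e \<subseteq> ?B k" using new old by blast
  qed (use assms leaf.rooted_tree_axioms subtree_occ_add_leaf in simp_all)
qed

lemma exists_decomposition_add_leaves:
  assumes "finite L" "L \<inter> V = {}" "\<forall>x\<in>L. host x < n"
  shows "\<exists>par' n' B'. rooted_decomposition par' n' B' (V \<union> L) (E \<union> leaf_edges B host L) \<and>
    n \<le> n' \<and> (\<forall>k<n. B' k = B k) \<and> (\<forall>k\<in>{n..<n'}. \<exists>x\<in>L. B' k = insert x (B (host x)))"
  using assms
proof (induction L rule: finite_induct)
  case empty
  show ?case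
    by (rule exI[of _ par], rule exI[of _ n], rule exI[of _ B]) (simp add: rooted_decomposition_axioms)
next
  case (insert x L)
  from insert obtain par' n' B'
    where dec: "rooted_decomposition par' n' B' (V \<union> L) (E \<union> leaf_edges B host L)"
      and old: "n \<le> n'" "\<forall>k<n. B' k = B k"
      and leaves: "\<forall>k\<in>{n..<n'}. \<exists>x\<in>L. B' k = insert x (B (host x))"
    by (elim meta_impE exE conjE) auto
  have x: "host x < n" "x \<notin> V \<union> L" using insert by auto
  let ?B = "B'(n' := insert x (B (host x)))"
  have "rooted_decomposition (par'(n' := host x)) (Suc n') ?B (V \<union> insert x L)
    (E \<union> leaf_edges B host (insert x L))"
    using rooted_decomposition.rooted_decomposition_add_leaf[OF dec, of "host x" x] x old
    by (simp add: leaf_edges_insert Un_assoc)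
  moreover have "\<exists>z\<in>insert x L. ?B k = insert z (B (host z))" if "k \<in> {n..<Suc n'}" for k
    using that leaves by (cases "k = n'") auto
  moreover have "n \<le> Suc n'" "\<forall>k<n. ?B k = B k" using old by auto
  ultimately show ?case
    by (intro exI[of _ "par'(n' := host x)"] exI[of _ "Suc n'"] exI[of _ ?B] conjI ballI)
qed

lemma treewidth_add_leaves:
  assumes L: "finite L" "L \<inter> V = {}" "\<forall>x\<in>L. host x < n"
    and w: "\<And>k. k < n \<Longrightarrow> card (B k) \<le> w"
  shows "treewidth (V \<union> L) (E \<union> leaf_edges B host L) \<le> w"
proof -
  obtain par' n' B' where dec: "rooted_decomposition par' n' B' (V \<union> L) (E \<union> leaf_edges B host L)"
    and old: "\<forall>k<n. B' k = B k" and leaves: "\<forall>k\<in>{n..<n'}. \<exists>x\<in>L. B' k = insert x (B (host x))"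
    using exists_decomposition_add_leaves[OF L] by blast
  have "card (B' k) \<le> w + 1" if "k < n'" for k
  proof (cases "k < n")
    case True
    then show ?thesis using old w[of k] by simp
  next
    case False
    then have "k \<in> {n..<n'}" using that by simp
    then obtain x where "x \<in> L" "B' k = insert x (B (host x))" using leaves by blast
    moreover have "card (B (host x)) \<le> w" using L w \<open>x \<in> L\<close> by blast
    ultimately show ?thesis by (simp add: card_insert_le_m1)
  qed
  then show ?thesis by (rule rooted_decomposition.treewidth_le[OF dec])
qed

end

section \<open>Rooting a tree decomposition\<close>

definition rooted_enumeration :: "nat set set \<Rightarrow> (nat \<Rightarrow> nat) \<Rightarrow> (nat \<Rightarrow> nat) \<Rightarrow> nat \<Rightarrow> bool" where
  "rooted_enumeration F par f m \<longleftrightarrow> rooted_tree par \<and> inj_on f {..<m} \<and>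
    (\<forall>k. 0 < k \<and> k < m \<longrightarrow> {f k, f (par k)} \<in> F)"

lemma rooted_enumeration_Suc:
  assumes enum: "rooted_enumeration F par f m" and m: "0 < m"
    and I: "f ` {..<m} \<subset> I" and con: "connected_set F I"
  shows "\<exists>par f. rooted_enumeration F par f (Suc m) \<and> f ` {..<Suc m} \<subseteq> I"
proof -
  interpret rooted_tree par using enum by (simp add: rooted_enumeration_def)
  have "f 0 \<in> I \<inter> f ` {..<m}" using m I by auto
  moreover obtain y where "y \<in> I - f ` {..<m}" using I by blast
  ultimately obtain u v where uv: "u \<in> I \<inter> f ` {..<m}" "v \<in> I - f ` {..<m}" "{u, v} \<in> F"
    by (rule connected_set_crossing[OF con])
  then obtain l where l: "l < m" "u = f l" by auto
  have "rooted_tree (par(m := l))"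
    using m l par_less by unfold_locales auto
  moreover have "inj_on (f(m := v)) {..<Suc m}"
    using enum uv by (auto simp: rooted_enumeration_def lessThan_Suc inj_on_def)
  moreover have "{(f(m := v)) k, (f(m := v)) ((par(m := l)) k)} \<in> F" if "0 < k" "k < Suc m" for k
    using that enum par_less[of k] l uv
    by (cases "k = m") (auto simp: rooted_enumeration_def insert_commute)
  ultimately have "rooted_enumeration F (par(m := l)) (f(m := v)) (Suc m)"
    by (simp add: rooted_enumeration_def)
  moreover have "(f(m := v)) ` {..<Suc m} \<subseteq> I" using I uv by (auto simp: lessThan_Suc)
  ultimately show ?thesis by blast
qed

lemma exists_rooted_enumeration:
  assumes tree: "is_tree I F"
  obtains par f where "rooted_enumeration F par f (card I)" "f ` {..<card I} = I"
proof -
  have fin: "finite I" and con: "connected_set F I" and ne: "I \<noteq> {}"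
    using tree by (auto simp: is_tree_def graph_def)
  have "\<exists>par f. rooted_enumeration F par f m \<and> f ` {..<m} \<subseteq> I" if "1 \<le> m" "m \<le> card I" for m
    using that
  proof (induction m rule: nat_induct_at_least)
    case base
    obtain x where "x \<in> I" using ne by blast
    moreover have "rooted_enumeration F (\<lambda>_. 0) (\<lambda>_. x) 1"
      by (auto simp: rooted_enumeration_def rooted_tree_def lessThan_Suc)
    ultimately show ?case by blast
  next
    case (Suc m)
    then obtain par f where IH: "rooted_enumeration F par f m" "f ` {..<m} \<subseteq> I" by auto
    then have "card (f ` {..<m}) = m" by (simp add: rooted_enumeration_def card_image)
    then have "f ` {..<m} \<subset> I" using IH Suc.prems by force
    then show ?case using rooted_enumeration_Suc[OF IH(1) _ _ con] Suc.hyps by simp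
  qed
  moreover have "1 \<le> card I" using fin ne by (simp add: Suc_leI card_gt_0_iff)
  ultimately obtain par f where pf: "rooted_enumeration F par f (card I)" "f ` {..<card I} \<subseteq> I" by blast
  then have "card (f ` {..<card I}) = card I" by (simp add: rooted_enumeration_def card_image)
  then show thesis using that pf fin card_subset_eq by blast
qed

lemma tree_edges_eq_parent_edges:
  assumes tree: "is_tree I F" and enum: "rooted_enumeration F par f (card I)"
  shows "F = (\<lambda>k. {f k, f (par k)}) ` {0<..<card I}"
proof -
  interpret rooted_tree par using enum by (simp add: rooted_enumeration_def)
  have "inj_on (\<lambda>k. f ` {k, par k}) {0<..<card I}"
  proof (rule inj_onI)
    fix x y
    assume x: "x \<in> {0<..<card I}" and y: "y \<in> {0<..<card I}"
      and eq: "f ` {x, par x} = f ` {y, par y}"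
    have "inj_on f {..<card I}" "{x, par x} \<subseteq> {..<card I}" "{y, par y} \<subseteq> {..<card I}"
      using enum x y par_less[of x] par_less[of y] by (auto simp: rooted_enumeration_def)
    then have "{x, par x} = {y, par y}" using eq by (simp only: inj_on_image_eq_iff)
    then show "x = y" using inj_onD[OF inj_on_parent_edge _ x y] by simp
  qed
  then have "card ((\<lambda>k. {f k, f (par k)}) ` {0<..<card I}) = card I - 1" by (simp add: card_image)
  also have "card I - 1 = card F" using tree by (auto simp: is_tree_def)
  finally have card: "card ((\<lambda>k. {f k, f (par k)}) ` {0<..<card I}) = card F" .
  have "F \<subseteq> Pow I" "finite I" using tree by (auto simp: is_tree_def graph_def)
  then have "finite F" by (simp add: finite_subset)
  moreover have "(\<lambda>k. {f k, f (par k)}) ` {0<..<card I} \<subseteq> F"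
    using enum by (auto simp: rooted_enumeration_def)
  ultimately show ?thesis using card by (intro card_subset_eq[symmetric])
qed

lemma (in rooted_tree) subtree_if_connected_image:
  assumes f: "inj_on f {..<n}" and N: "N \<subseteq> {..<n}" and con: "connected_set F (f ` N)"
    and F: "F = (\<lambda>k. {f k, f (par k)}) ` {0<..<n}"
  shows "subtree N"
  unfolding subtree_def
proof (intro ballI impI)
  fix j k assume jk: "j \<in> N" "k \<in> N" "j < k"
  have f_eq: "f x = f y \<longleftrightarrow> x = y" if "x < n" "y < n" for x y
    using that f by (auto dest: inj_onD)
  let ?A = "f ` (desc k \<inter> N)"
  have "j \<notin> desc k" using desc_ge jk(3) leD by blast
  then have "f k \<in> f ` N \<inter> ?A" "f j \<in> f ` N - ?A" using jk f_eq N by auto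
  then obtain u v where u: "u \<in> f ` N \<inter> ?A" and v: "v \<in> f ` N - ?A" and uv: "{u, v} \<in> F"
    by (rule connected_set_crossing[OF con])
  obtain x where x: "x \<in> N" "x \<in> desc k" "u = f x" using u by blast
  obtain y where y: "y \<in> N" "y \<notin> desc k" "v = f y" using v by blast
  obtain c where c: "0 < c" "c < n" "{f x, f y} = {f c, f (par c)}" using uv x y F by auto
  then have "par c < n" using par_less[of c] by simp
  then have "x = c \<and> y = par c \<or> x = par c \<and> y = c"
    using c(2,3) x(1) y(1) N f_eq by (auto simp: doubleton_eq_iff)
  then have "y = par x" using x(2) y(2) in_desc_if_par[of y k] by blast
  moreover have "x = k" using par_in_desc[OF x(2)] y(2) calculation by blast
  ultimately show "par k \<in> N" using y(1) by simp
qed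

lemma exists_tree_decomposition_treewidth:
  assumes "graph V E"
  obtains I F B where "tree_decomposition V E I F B" "\<And>i. i \<in> I \<Longrightarrow> card (B i) \<le> treewidth V E + 1"
proof -
  let ?P = "\<lambda>k. \<exists>I F B. tree_decomposition V E I F B \<and> (\<forall>i\<in>I. card (B i) \<le> k + 1)"
  have "tree_decomposition V E {0} {} (\<lambda>_. V)"
    using assms by (auto simp: tree_decomposition_def is_tree_def graph_def connected_set_def)
  then have "?P (card V)" by (intro exI[of _ "{0}"] exI[of _ "{}"] exI[of _ "\<lambda>_. V"]) simp
  then have "?P (treewidth V E)" unfolding treewidth_def by (rule LeastI)
  then show thesis using that by blast
qed

lemma exists_rooted_decomposition:
  assumes "graph V E"
  obtains par n B where "rooted_decomposition par n B V E"
    "\<And>k. k < n \<Longrightarrow> card (B k) \<le> treewidth V E + 1"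
proof -
  obtain I F B where td: "tree_decomposition V E I F B"
    and w: "\<And>i. i \<in> I \<Longrightarrow> card (B i) \<le> treewidth V E + 1"
    using exists_tree_decomposition_treewidth[OF assms] by blast
  have tree: "is_tree I F" using td by (simp add: tree_decomposition_def)
  obtain par f where enum: "rooted_enumeration F par f (card I)" and f: "f ` {..<card I} = I"
    using exists_rooted_enumeration[OF tree] by blast
  interpret rooted_tree par using enum by (simp add: rooted_enumeration_def)
  have ex: "(\<exists>i\<in>I. P i) \<longleftrightarrow> (\<exists>k<card I. P (f k))" for P using f by (metis imageE imageI lessThan_iff)
  have "subtree (occ (card I) (B \<circ> f) {v})" if "v \<in> V" for v
  proof (rule subtree_if_connected_image)
    show "inj_on f {..<card I}" using enum by (simp add: rooted_enumeration_def)
    have "f ` occ (card I) (B \<circ> f) {v} = {i \<in> I. v \<in> B i}" using f by (auto simp: occ_def)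
    then show "connected_set F (f ` occ (card I) (B \<circ> f) {v})"
      using td that by (simp add: tree_decomposition_def)
  qed (rule occ_lessThan tree_edges_eq_parent_edges[OF tree enum])+
  moreover have "0 < card I" using tree by (auto simp: is_tree_def)
  ultimately have "rooted_decomposition par (card I) (B \<circ> f) V E"
    using td f unfolding tree_decomposition_def ex by unfold_locales auto
  moreover have "card ((B \<circ> f) k) \<le> treewidth V E + 1" if "k < card I" for k
    using that w f by auto
  ultimately show thesis using that by blast
qed

section \<open>Bridging the gaps\<close>

locale nonpiercing_decomposition = rooted_decomposition par n B V E
  for par n and B :: "nat \<Rightarrow> 'v set" and V E +
  fixes \<F> :: "'v set set"
  assumes finite_vertices: "finite V" and non_piercing: "non_piercing V E \<F>"
begin

lemma member_subset: "H \<in> \<F> \<Longrightarrow> H \<subseteq> V"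
  using non_piercing by (simp add: non_piercing_def)

lemma finite_family: "finite \<F>"
  using member_subset finite_vertices by (meson PowI finite_Pow_iff finite_subset subsetI)

lemma finite_bag: "k < n \<Longrightarrow> finite (B k)"
  using bag_subset finite_vertices finite_subset by blast

lemma subtree_occ_member: "H \<in> \<F> \<Longrightarrow> subtree (occ n B H)"
  using non_piercing by (intro subtree_occ) (auto simp: non_piercing_def)

lemma subtree_occ_Diff: "H \<in> \<F> \<Longrightarrow> G \<in> \<F> \<Longrightarrow> subtree (occ n B (H - G))"
  using non_piercing by (intro subtree_occ) (auto simp: non_piercing_def)

end

text \<open>A gap between the nodes where K \<inter> C occurs is bridged by copying one vertex of K \<inter> C from each
  of its ends into all bags of the gap. By non-piercing, any L in the family with the same trace as K
  on an original bag inside the gap contains one of the two vertices, so every trace pays for at most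
  two new vertices of that bag. The sets S k collect the traces that have been paid for.\<close>
locale bridging = nonpiercing_decomposition par n B V E \<F> + enlarged: rooted_decomposition par n B' V E
  for par n and B :: "nat \<Rightarrow> 'v set" and V E \<F> and B' :: "nat \<Rightarrow> 'v set" +
  fixes C :: "'v set" and S :: "nat \<Rightarrow> 'v set set"
  assumes bag_mono: "k < n \<Longrightarrow> B k \<subseteq> B' k"
    and paid_traces: "k < n \<Longrightarrow> S k \<subseteq> Pow (B k)"
    and card_enlarged_bag: "k < n \<Longrightarrow> card (B' k) \<le> card (B k) + 2 * card (S k)"
    and paid_trace_occurs: "k < n \<Longrightarrow> K \<in> \<F> \<Longrightarrow> K \<inter> B k \<in> S k \<Longrightarrow> k \<in> occ n B' (K \<inter> C)"
begin

lemma finite_paid_traces: "k < n \<Longrightarrow> finite (S k)"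
  using paid_traces finite_bag by (meson finite_Pow_iff finite_subset)

lemma card_enlarged_bag_le:
  assumes "k < n"
  shows "card (B' k) \<le> card (B k) + 2 * 2 ^ card (B k)"
proof -
  have "card (S k) \<le> card (Pow (B k))"
    using paid_traces assms finite_bag by (intro card_mono) auto
  then show ?thesis using card_enlarged_bag[OF assms] finite_bag[OF assms] by (simp add: card_Pow)
qed

lemma occ_bag_mono: "occ n B D \<subseteq> occ n B' D"
  using bag_mono by (fastforce simp: occ_iff)

end

locale gap = bridging par n B V E \<F> B' C S
  for par n and B :: "nat \<Rightarrow> 'v set" and V E \<F> B' C S +
  fixes K :: "'v set" and i j :: nat and a b :: 'v
  assumes K: "K \<in> \<F>"
    and gap: "hull i j \<inter> occ n B' (K \<inter> C) = {i, j}" "hull i j \<noteq> {i, j}"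
    and ends: "a \<in> K \<inter> C" "i \<in> occ n B' {a}" "b \<in> K \<inter> C" "j \<in> occ n B' {b}"
begin

definition interior :: "nat set" where
  "interior = hull i j - {i, j}"

definition bridged_bag :: "nat \<Rightarrow> 'v set" where
  "bridged_bag k = (if k \<in> interior then B' k \<union> {a, b} else B' k)"

definition paid :: "nat \<Rightarrow> 'v set set" where
  "paid k = (if k \<in> interior then insert (K \<inter> B k) (S k) else S k)"

lemma interior_nonempty: "interior \<noteq> {}"
  using gap(2) hull_ends(1)[of i j] hull_ends(2)[of j i] unfolding interior_def by blast

lemma ends_neq: "i \<noteq> j"
  using interior_nonempty by (auto simp: interior_def)

lemma interior_lessThan: "interior \<subseteq> {..<n}"
proof -
  have "hull i j \<subseteq> {..<n}"
    using ends by (intro hull_least subtree_lessThan) (auto simp: occ_iff)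
  then show ?thesis by (auto simp: interior_def)
qed

lemma interior_unoccupied: "k \<in> interior \<Longrightarrow> k \<notin> occ n B' (K \<inter> C)"
  using gap(1) by (auto simp: interior_def)

lemma end_vertices: "a \<in> V" "b \<in> V"
  using ends member_subset[OF K] by auto

lemma trace_unpaid: "k \<in> interior \<Longrightarrow> K \<inter> B k \<notin> S k"
  using paid_trace_occurs[OF _ K] interior_unoccupied interior_lessThan by blast

lemma bag_subset_bridged_bag: "B' k \<subseteq> bridged_bag k"
  by (auto simp: bridged_bag_def)

lemma occ_subset_occ_bridged: "occ n B' D \<subseteq> occ n bridged_bag D"
  using bag_subset_bridged_bag by (fastforce simp: occ_iff)

lemma occ_bridged_bag:
  "occ n bridged_bag {x} = occ n B' {x} \<union> (if x = a \<or> x = b then interior else {})"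
  using interior_lessThan by (auto simp: occ_iff bridged_bag_def split: if_splits)

lemma subtree_occ_bridged_bag:
  assumes "x \<in> V"
  shows "subtree (occ n bridged_bag {x})"
proof -
  have extended: "subtree (occ n B' {y} \<union> (hull p q - {q}))"
    if "y \<in> V" "p \<in> occ n B' {y}" "p \<noteq> q" for y p q
    using that by (intro subtree_Un[where c = p] enlarged.subtree_occ_vertex subtree_hull_Diff_end) auto
  consider "x = a" | "x = b" | "x \<noteq> a" "x \<noteq> b" by blast
  then show ?thesis
  proof cases
    case 1
    then have "occ n bridged_bag {x} = occ n B' {x} \<union> (hull i j - {j})"
      using ends by (auto simp: occ_bridged_bag interior_def)
    then show ?thesis using extended[of a i j] ends ends_neq end_vertices 1 by simp
  next
    case 2
    then have "occ n bridged_bag {x} = occ n B' {x} \<union> (hull j i - {i})"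
      using ends by (auto simp: occ_bridged_bag interior_def hull_commute[of j i])
    then show ?thesis using extended[of b j i] ends ends_neq end_vertices 2 by simp
  next
    case 3
    then show ?thesis using assms enlarged.subtree_occ_vertex by (simp add: occ_bridged_bag)
  qed
qed

lemma equal_trace_contains_end:
  assumes L: "L \<in> \<F>" and k: "k \<in> interior" and trace: "L \<inter> B k = K \<inter> B k"
  shows "a \<in> L \<or> b \<in> L"
proof (rule ccontr)
  assume "\<not> (a \<in> L \<or> b \<in> L)"
  then have ab: "a \<in> K - L" "b \<in> K - L" using ends by auto
  let ?M = "occ n B (K - L) \<union> occ n B' {a} \<union> occ n B' {b}"
  obtain p where p: "p \<in> occ n B {a}" using vertex_in_bag end_vertices by (auto simp: occ_iff)
  obtain q where q: "q \<in> occ n B {b}" using vertex_in_bag end_vertices by (auto simp: occ_iff)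
  have "p \<in> occ n B (K - L)" "q \<in> occ n B (K - L)" using p q ab by (auto simp: occ_iff)
  moreover have "p \<in> occ n B' {a}" "q \<in> occ n B' {b}" using p q occ_bag_mono by blast+
  ultimately have "subtree ?M"
    using end_vertices subtree_occ_Diff[OF K L]
    by (intro subtree_Un[where c = q] subtree_Un[where c = p] enlarged.subtree_occ_vertex) auto
  then have "hull i j \<subseteq> ?M" using ends by (intro hull_least) auto
  moreover have "k \<notin> occ n B' {a} \<union> occ n B' {b}"
    using interior_unoccupied[OF k] ends by (auto simp: occ_iff)
  ultimately have "k \<in> occ n B (K - L)" using k by (auto simp: interior_def)
  then show False using trace by (auto simp: occ_iff)
qed

lemma paid_trace_occurs_bridged:
  assumes k: "k < n" and L: "L \<in> \<F>" and trace: "L \<inter> B k \<in> paid k"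
  shows "k \<in> occ n bridged_bag (L \<inter> C)"
proof (cases "L \<inter> B k \<in> S k")
  case True
  then show ?thesis using paid_trace_occurs[OF k L] occ_subset_occ_bridged by blast
next
  case False
  then have "k \<in> interior" "L \<inter> B k = K \<inter> B k" using trace by (auto simp: paid_def split: if_splits)
  then show ?thesis
    using equal_trace_contains_end[OF L] ends k by (auto simp: occ_iff bridged_bag_def)
qed

lemma card_bridged_bag:
  assumes "k < n"
  shows "card (bridged_bag k) \<le> card (B k) + 2 * card (paid k)"
proof (cases "k \<in> interior")
  case True
  have "card (bridged_bag k) \<le> card (B' k) + card {a, b}"
    using True card_Un_le[of "B' k" "{a, b}"] by (simp only: bridged_bag_def if_True)
  also have "card {a, b} \<le> 2" by (simp add: card_insert_le_m1)
  finally show ?thesis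
    using card_enlarged_bag[OF assms] trace_unpaid[OF True] finite_paid_traces[OF assms] True
    by (simp add: paid_def)
qed (use card_enlarged_bag[OF assms] in \<open>simp add: bridged_bag_def paid_def\<close>)

lemma bridging_bridged_bag: "bridging par n B V E \<F> bridged_bag C paid"
proof
  show "bridged_bag k \<subseteq> V" if "k < n" for k
    using that enlarged.bag_subset end_vertices by (auto simp: bridged_bag_def)
  show "\<exists>k<n. v \<in> bridged_bag k" if "v \<in> V" for v
    using enlarged.vertex_in_bag[OF that] bag_subset_bridged_bag by blast
  show "\<exists>k<n. e \<subseteq> bridged_bag k" if "e \<in> E" for e
    using enlarged.edge_in_bag[OF that] bag_subset_bridged_bag by blast
  show "B k \<subseteq> bridged_bag k" if "k < n" for k
    using bag_mono[OF that] bag_subset_bridged_bag by blast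
  show "paid k \<subseteq> Pow (B k)" if "k < n" for k
    using paid_traces[OF that] by (auto simp: paid_def)
qed (rule nodes_nonempty subtree_occ_bridged_bag card_bridged_bag paid_trace_occurs_bridged; assumption)+

lemma unpaid_traces_decrease:
  "(\<Sum>k<n. card (Pow (B k) - paid k)) < (\<Sum>k<n. card (Pow (B k) - S k))"
proof (rule sum_strict_mono_ex1)
  show "\<forall>k\<in>{..<n}. card (Pow (B k) - paid k) \<le> card (Pow (B k) - S k)"
    using finite_bag by (auto simp: paid_def intro!: card_mono)
  obtain k where k: "k \<in> interior" using interior_nonempty by blast
  then have "k < n" using interior_lessThan by blast
  moreover have "card (Pow (B k) - paid k) < card (Pow (B k) - S k)"
    using finite_bag[OF \<open>k < n\<close>] trace_unpaid[OF k] k by (intro psubset_card_mono) (auto simp: paid_def)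
  ultimately show "\<exists>k\<in>{..<n}. card (Pow (B k) - paid k) < card (Pow (B k) - S k)" by blast
qed simp

end

lemma (in bridging) exists_gap:
  assumes "K \<in> \<F>" "\<not> subtree (occ n B' (K \<inter> C))"
  obtains i j a b where "gap par n B V E \<F> B' C S K i j a b"
proof -
  obtain i j where ij: "i \<in> occ n B' (K \<inter> C)" "j \<in> occ n B' (K \<inter> C)"
      "hull i j \<inter> occ n B' (K \<inter> C) = {i, j}" "hull i j \<noteq> {i, j}"
    using subtree_gap[OF assms(2)] by blast
  obtain a where a: "a \<in> K \<inter> C" "i \<in> occ n B' {a}" using ij(1) by (auto simp: occ_iff)
  obtain b where b: "b \<in> K \<inter> C" "j \<in> occ n B' {b}" using ij(2) by (auto simp: occ_iff)
  have "gap par n B V E \<F> B' C S K i j a b"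
    using assms(1) ij a b by unfold_locales
  then show thesis by (rule that)
qed

lemma exists_gapless_bridging:
  assumes "bridging par n B V E \<F> B' C S"
  shows "\<exists>B' S. bridging par n B V E \<F> B' C S \<and>
    (\<forall>K\<in>\<F>. rooted_tree.subtree par (occ n B' (K \<inter> C)))"
  using assms
proof (induction "\<Sum>k<n. card (Pow (B k) - S k)" arbitrary: B' S rule: less_induct)
  case less
  interpret bridging par n B V E \<F> B' C S by (rule less.prems)
  show ?case
  proof (cases "\<forall>K\<in>\<F>. subtree (occ n B' (K \<inter> C))")
    case True
    then show ?thesis using less.prems by blast
  next
    case False
    then obtain K where "K \<in> \<F>" "\<not> subtree (occ n B' (K \<inter> C))" by blast
    then obtain i j a b where "gap par n B V E \<F> B' C S K i j a b" by (rule exists_gap)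
    then interpret gap par n B V E \<F> B' C S K i j a b .
    show ?thesis by (rule less.hyps[OF unpaid_traces_decrease bridging_bridged_bag])
  qed
qed

lemma (in nonpiercing_decomposition) exists_gapless_decomposition:
  assumes w: "\<And>k. k < n \<Longrightarrow> card (B k) \<le> w"
  obtains B' where "rooted_decomposition par n B' V E"
    "\<And>k. k < n \<Longrightarrow> card (B' k) \<le> w + 2 * 2 ^ w"
    "\<And>K. K \<in> \<F> \<Longrightarrow> subtree (occ n B' (K \<inter> C))"
proof -
  have "bridging par n B V E \<F> B C (\<lambda>_. {})" by unfold_locales auto
  from exists_gapless_bridging[OF this] obtain B' S where B': "bridging par n B V E \<F> B' C S"
    and gapless: "\<And>K. K \<in> \<F> \<Longrightarrow> subtree (occ n B' (K \<inter> C))"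
    by blast
  interpret B': bridging par n B V E \<F> B' C S by (rule B')
  have "card (B' k) \<le> w + 2 * 2 ^ w" if k: "k < n" for k
  proof -
    have "(2::nat) ^ card (B k) \<le> 2 ^ w" using w[OF k] by (intro power_increasing) auto
    then show ?thesis using B'.card_enlarged_bag_le[OF k] w[OF k] by linarith
  qed
  then show thesis using that B'.enlarged.rooted_decomposition_axioms gapless by blast
qed

section \<open>Pruning the sets along the tree\<close>

definition active :: "'v set set \<Rightarrow> ('v set \<Rightarrow> nat set) \<Rightarrow> nat \<Rightarrow> 'v set set" where
  "active \<F> R x = {H \<in> \<F>. x \<in> R H}"

definition (in rooted_tree) edge_bag :: "'v set set \<Rightarrow> ('v set \<Rightarrow> nat set) \<Rightarrow> nat \<Rightarrow> 'v set set" where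
  "edge_bag \<F> R x = active \<F> R x \<union> active \<F> R (par x)"

text \<open>R H is the set of nodes at which H is active; the nodes smaller than m have been processed.
  In the boundary condition, G contains everything that H has beyond the edge between x and y.\<close>
locale pruning = nonpiercing_decomposition par n B V E \<F>
  for par n and B :: "nat \<Rightarrow> 'v set" and V E \<F> +
  fixes m :: nat and R :: "'v set \<Rightarrow> nat set"
  assumes subtree_active: "H \<in> \<F> \<Longrightarrow> subtree (R H)"
    and active_subset_occ: "H \<in> \<F> \<Longrightarrow> R H \<subseteq> occ n B H"
    and inj_on_trace: "x < m \<Longrightarrow> inj_on (\<lambda>H. H \<inter> B x) (active \<F> R x)"
    and boundary: "\<lbrakk>H \<in> \<F>; adjacent x y; x \<in> R H; y \<in> occ n B H; y \<notin> R H\<rbrakk>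
      \<Longrightarrow> y < m \<and> (\<exists>G\<in>active \<F> R y. occ n B (H - G) \<inter> side x y = {})"
    and inactive_covered: "\<lbrakk>H \<in> \<F>; H \<noteq> {}; R H = {}\<rbrakk> \<Longrightarrow> \<exists>x<m. H \<subseteq> \<Union>(edge_bag \<F> R x)"

lemma (in nonpiercing_decomposition) pruning_0: "pruning par n B V E \<F> 0 (occ n B)"
proof unfold_locales
  fix H assume H: "H \<in> \<F>" "H \<noteq> {}" "occ n B H = {}"
  then obtain v where "v \<in> H" "v \<in> V" using member_subset by blast
  then show "\<exists>x<0. H \<subseteq> \<Union>(edge_bag \<F> (occ n B) x)"
    using vertex_in_bag[of v] H by (auto simp: occ_def)
qed (simp_all add: subtree_occ_member)

locale pruning_step = pruning par n B V E \<F> m R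
  for par n and B :: "nat \<Rightarrow> 'v set" and V E \<F> m R +
  assumes current: "m < n"
begin

definition inherited :: "'v set set" where
  "inherited = {H \<in> active \<F> R m. 0 < m \<and> par m \<in> R H}"

lemma inherited_subset_active: "inherited \<subseteq> active \<F> R m"
  by (auto simp: inherited_def)

lemma active_member: "H \<in> active \<F> R m \<Longrightarrow> H \<in> \<F>" "H \<in> active \<F> R m \<Longrightarrow> m \<in> R H"
  by (simp_all add: active_def)

lemma inherited_nested:
  assumes "G \<in> inherited" "G' \<in> inherited" "G \<inter> B m = G' \<inter> B m"
  shows "occ n B (G - G') \<inter> desc m = {} \<or> occ n B (G' - G) \<inter> desc m = {}"
proof (cases "G = G'")
  case False
  have m: "0 < m" and GF: "G \<in> \<F>" "G' \<in> \<F>" using assms by (auto simp: inherited_def active_def)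
  have above: "occ n B (X - Y) \<inter> desc m = {}"
    if "X \<in> \<F>" "Y \<in> \<F>" "X \<inter> B m = Y \<inter> B m" "(X - Y) \<inter> B (par m) \<noteq> {}" for X Y
  proof -
    have "par m \<in> occ n B (X - Y)" using that par_less[OF m] current by (auto simp: occ_def)
    moreover have "par m \<notin> desc m" using desc_ge par_less[OF m] leD by blast
    moreover have "m \<notin> occ n B (X - Y)" using that(3) by (auto simp: occ_def)
    ultimately show ?thesis using subtree_crossing_desc[OF subtree_occ_Diff[OF that(1,2)]] by blast
  qed
  have "G \<inter> B (par m) \<noteq> G' \<inter> B (par m)"
    using inj_onD[OF inj_on_trace[OF par_less[OF m]], of G G'] False assms
    by (auto simp: inherited_def active_def)
  then have "(G - G') \<inter> B (par m) \<noteq> {} \<or> (G' - G) \<inter> B (par m) \<noteq> {}" by blast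
  then show ?thesis using above[of G G'] above[of G' G] GF assms(3) by auto
qed (simp add: occ_def)

lemma exists_largest_inherited:
  assumes "G \<in> inherited"
  obtains A where "A \<in> inherited" "A \<inter> B m = G \<inter> B m"
    "\<And>H. H \<in> inherited \<Longrightarrow> H \<inter> B m = G \<inter> B m \<Longrightarrow> occ n B (H - A) \<inter> desc m = {}"
proof -
  define below where "below = \<Union>(B ` (desc m \<inter> {..<n}))"
  define \<C> where "\<C> = {H \<in> inherited. H \<inter> B m = G \<inter> B m}"
  have occ_below: "occ n B (H - A) \<inter> desc m = {} \<longleftrightarrow> H \<inter> below \<subseteq> A \<inter> below" for H A
    by (auto simp: occ_def below_def)
  have "finite \<C>"
    using finite_subset[OF _ finite_family, of \<C>] by (auto simp: \<C>_def inherited_def active_def)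
  moreover have "G \<in> \<C>" using assms by (simp add: \<C>_def)
  moreover have "subset.chain UNIV ((\<lambda>H. H \<inter> below) ` \<C>)"
    using inherited_nested unfolding occ_below by (fastforce simp: subset_chain_def \<C>_def)
  ultimately have "\<Union>((\<lambda>H. H \<inter> below) ` \<C>) \<in> (\<lambda>H. H \<inter> below) ` \<C>"
    by (intro Union_in_chain) auto
  then obtain A where "A \<in> \<C>" and A: "\<Union>((\<lambda>H. H \<inter> below) ` \<C>) = A \<inter> below" by blast
  moreover have "H \<inter> below \<subseteq> A \<inter> below" if "H \<in> \<C>" for H using A that by blast
  ultimately show thesis using that[of A] by (simp add: \<C>_def occ_below)
qed

definition represents :: "'v set \<Rightarrow> 'v set \<Rightarrow> bool" where
  "represents A T \<longleftrightarrow> A \<in> active \<F> R m \<and> A \<inter> B m = T \<and>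
    (\<forall>H\<in>inherited. H \<inter> B m = T \<longrightarrow> occ n B (H - A) \<inter> desc m = {})"

definition rep :: "'v set \<Rightarrow> 'v set" where
  "rep H = (SOME A. represents A (H \<inter> B m))"

lemma represents_rep:
  assumes "H \<in> active \<F> R m"
  shows "represents (rep H) (H \<inter> B m)"
proof -
  have "\<exists>A. represents A (H \<inter> B m)"
  proof (cases "\<exists>G\<in>inherited. G \<inter> B m = H \<inter> B m")
    case True
    then obtain G where G: "G \<in> inherited" "G \<inter> B m = H \<inter> B m" by blast
    from exists_largest_inherited[OF G(1)] show ?thesis
      using G(2) inherited_subset_active unfolding represents_def by (metis subsetD)
  next
    case False
    then show ?thesis using assms by (auto simp: represents_def)
  qed
  then show ?thesis unfolding rep_def by (rule someI_ex)
qed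

lemma rep_active: "H \<in> active \<F> R m \<Longrightarrow> rep H \<in> active \<F> R m"
  and trace_rep: "H \<in> active \<F> R m \<Longrightarrow> rep H \<inter> B m = H \<inter> B m"
  using represents_rep by (simp_all add: represents_def)

lemma rep_eq_if_trace_eq: "G \<inter> B m = H \<inter> B m \<Longrightarrow> rep G = rep H"
  by (simp add: rep_def)

lemma rep_rep: "H \<in> active \<F> R m \<Longrightarrow> rep (rep H) = rep H"
  using trace_rep by (rule rep_eq_if_trace_eq)

text \<open>An inherited set must be cut below m, so that nothing changes at the processed nodes.\<close>
definition leaves_towards :: "'v set \<Rightarrow> nat \<Rightarrow> bool" where
  "leaves_towards H y \<longleftrightarrow> adjacent m y \<and> occ n B (H - rep H) \<subseteq> side m y \<and> (H \<in> inherited \<longrightarrow> y = par m)"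

definition direction :: "'v set \<Rightarrow> nat" where
  "direction H = (SOME y. leaves_towards H y)"

lemma leaves_towards_direction:
  assumes H: "H \<in> active \<F> R m"
  shows "leaves_towards H (direction H)"
proof -
  have "\<exists>y. leaves_towards H y"
  proof (cases "H \<in> inherited")
    case True
    then have "0 < m" by (simp add: inherited_def)
    moreover have "occ n B (H - rep H) \<inter> desc m = {}"
      using represents_rep[OF H] True by (simp add: represents_def)
    ultimately have "leaves_towards H (par m)"
      using adjacent_par by (auto simp: leaves_towards_def side_par)
    then show ?thesis by blast
  next
    case False
    have "m \<notin> occ n B (H - rep H)" using trace_rep[OF H] by (auto simp: occ_def)
    with subtree_occ_Diff[OF active_member(1)[OF H] active_member(1)[OF rep_active[OF H]]]
    obtain y where "adjacent m y" "occ n B (H - rep H) \<subseteq> side m y" by (rule subtree_within_side)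
    then show ?thesis using False by (auto simp: leaves_towards_def)
  qed
  then show ?thesis unfolding direction_def by (rule someI_ex)
qed

definition prune :: "'v set \<Rightarrow> nat set" where
  "prune H = (if H \<in> active \<F> R m \<and> rep H \<noteq> H then R H \<inter> side m (direction H) else R H)"

lemma prune_cases:
  obtains (keep) "prune H = R H" "H \<in> active \<F> R m \<Longrightarrow> rep H = H"
  | (cut) y where "H \<in> active \<F> R m" "rep H \<noteq> H" "prune H = R H \<inter> side m y" "adjacent m y"
      "occ n B (H - rep H) \<subseteq> side m y" "H \<in> inherited \<Longrightarrow> y = par m"
proof (cases "H \<in> active \<F> R m \<and> rep H \<noteq> H")
  case True
  then show thesis
    using leaves_towards_direction[of H]
    by (intro cut[of "direction H"]) (auto simp: prune_def leaves_towards_def)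
next
  case False
  then show thesis by (intro keep) (auto simp: prune_def)
qed

lemma prune_processed:
  assumes "H \<in> \<F>" "q < m"
  shows "q \<in> prune H \<longleftrightarrow> q \<in> R H"
proof (cases rule: prune_cases[of H])
  case (cut y)
  show ?thesis
  proof (cases "H \<in> inherited")
    case True
    then have "side m y = - desc m" using cut(6) by (simp add: side_par inherited_def)
    then show ?thesis using cut(3) desc_ge[of q m] assms(2) by auto
  next
    case False
    then have "q \<notin> R H"
      using subtreeD[OF subtree_active[OF assms(1)], of q m] cut(1) assms(2)
      by (auto simp: inherited_def active_def)
    then show ?thesis using cut(3) by simp
  qed
qed simp

lemma active_prune_processed: "q < m \<Longrightarrow> active \<F> prune q = active \<F> R q"
  using prune_processed by (auto simp: active_def)

lemma prune_current:
  assumes "H \<in> \<F>"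
  shows "m \<in> prune H \<longleftrightarrow> m \<in> R H \<and> rep H = H"
proof (cases rule: prune_cases[of H])
  case keep
  then show ?thesis using assms by (auto simp: active_def)
next
  case (cut y)
  then show ?thesis using side_ends(2)[OF cut(4)] by simp
qed

lemma rep_in_active_prune:
  assumes "H \<in> active \<F> R m"
  shows "rep H \<in> active \<F> prune m"
  using active_member[OF rep_active[OF assms]] prune_current rep_rep[OF assms] by (simp add: active_def)

lemma inj_on_trace_prune:
  assumes "q < Suc m"
  shows "inj_on (\<lambda>H. H \<inter> B q) (active \<F> prune q)"
proof (cases "q = m")
  case True
  show ?thesis
    unfolding True
  proof (rule inj_onI)
    fix H G assume "H \<in> active \<F> prune m" "G \<in> active \<F> prune m" "H \<inter> B m = G \<inter> B m"
    then show "H = G"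
      using prune_current[of H] prune_current[of G] rep_eq_if_trace_eq[of H G] by (auto simp: active_def)
  qed
next
  case False
  then have "q < m" using assms by simp
  then show ?thesis using inj_on_trace by (simp add: active_prune_processed)
qed

lemma boundary_prune:
  assumes H: "H \<in> \<F>" and xy: "adjacent x y" "x \<in> prune H" "y \<in> occ n B H" "y \<notin> prune H"
  shows "y < Suc m \<and> (\<exists>G\<in>active \<F> prune y. occ n B (H - G) \<inter> side x y = {})"
proof (cases "y \<in> R H")
  case False
  have "x \<in> R H" using xy(2) by (auto simp: prune_def split: if_splits)
  then obtain G where G: "y < m" "G \<in> active \<F> R y" "occ n B (H - G) \<inter> side x y = {}"
    using boundary[OF H xy(1) _ xy(3) False] by blast
  then have "G \<in> active \<F> prune y" using active_prune_processed by simp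
  then show ?thesis using G by (auto intro: less_SucI)
next
  case True
  then have "H \<in> active \<F> R m" using xy by (auto simp: prune_def split: if_splits)
  obtain z where z: "prune H = R H \<inter> side m z" "adjacent m z" "occ n B (H - rep H) \<subseteq> side m z"
    using True xy(4) by (cases rule: prune_cases[of H]) auto
  have xz: "x \<in> side m z" "y \<notin> side m z" using z(1) xy True by auto
  then have "m \<in> {x, y}" "z \<in> {x, y}"
    using subtree_crossing[OF subtree_adjacent[OF xy(1)] z(2), of x y] by auto
  then have "y = m" "x = z" using xz side_ends[OF z(2)] by auto
  then have "occ n B (H - rep H) \<inter> side x y = {}" using z side_commute[OF z(2)] by auto
  then show ?thesis using rep_in_active_prune[OF \<open>H \<in> active \<F> R m\<close>] \<open>y = m\<close> by blast
qed

lemma inactive_covered_prune: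
  assumes H: "H \<in> \<F>" "H \<noteq> {}" and pruned: "prune H = {}"
  shows "\<exists>x<Suc m. H \<subseteq> \<Union>(edge_bag \<F> prune x)"
proof (cases rule: prune_cases[of H])
  case keep
  then obtain x where x: "x < m" "H \<subseteq> \<Union>(edge_bag \<F> R x)" using inactive_covered[OF H] pruned by auto
  have "edge_bag \<F> R x = edge_bag \<F> prune x"
    using x(1) par_le[of x] by (simp add: edge_bag_def active_prune_processed)
  then show ?thesis using x by (auto intro: less_SucI)
next
  case (cut y)
  have "v \<in> \<Union>(edge_bag \<F> prune m)" if v: "v \<in> H" for v
  proof -
    obtain p where p: "p < n" "v \<in> B p" using v member_subset[OF H(1)] vertex_in_bag by blast
    show ?thesis
    proof (cases "p \<in> side m y")
      case False
      then have "v \<in> rep H" using cut(5) p v by (auto simp: occ_def)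
      then show ?thesis using rep_in_active_prune[OF cut(1)] by (auto simp: edge_bag_def)
    next
      case True
      have "m \<in> occ n B H" "p \<in> occ n B H"
        using active_member[OF cut(1)] active_subset_occ p v by (auto simp: occ_def)
      then have "y \<in> occ n B H"
        using subtree_crossing(2)[OF subtree_occ_member[OF H(1)] cut(4)] True side_ends[OF cut(4)]
        by blast
      moreover have "y \<notin> R H" using cut(3) pruned side_ends(1)[OF cut(4)] by blast
      ultimately obtain G where G: "y < m" "G \<in> active \<F> R y" "occ n B (H - G) \<inter> side m y = {}"
        using boundary[OF H(1) cut(4) active_member(2)[OF cut(1)]] by blast
      have "v \<in> G" using G(3) True p v by (auto simp: occ_def)
      moreover have "G \<in> edge_bag \<F> prune m"
        using adjacent_less[OF cut(4) G(1)] active_prune_processed[OF G(1)] G(2)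
        by (simp add: edge_bag_def)
      ultimately show ?thesis by blast
    qed
  qed
  then show ?thesis by blast
qed

lemma pruning_prune: "pruning par n B V E \<F> (Suc m) prune"
proof unfold_locales
  show "subtree (prune H)" if "H \<in> \<F>" for H
    using subtree_active[OF that] subtree_side by (simp add: prune_def subtree_Int)
  show "prune H \<subseteq> occ n B H" if "H \<in> \<F>" for H
    using active_subset_occ[OF that] by (auto simp: prune_def)
qed (use inj_on_trace_prune boundary_prune inactive_covered_prune in blast)+

end

lemma (in nonpiercing_decomposition) exists_pruning:
  "m \<le> n \<Longrightarrow> \<exists>R. pruning par n B V E \<F> m R"
proof (induction m)
  case 0
  then show ?case using pruning_0 by blast
next
  case (Suc m)
  then obtain R where "pruning par n B V E \<F> m R" by auto
  then interpret pruning_step par n B V E \<F> m R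
    using Suc.prems by (simp add: pruning_step_def pruning_step_axioms_def)
  show ?case using pruning_prune by blast
qed

section \<open>The support\<close>

locale complete_pruning = pruning par n B V E \<F> n R
  for par n and B :: "nat \<Rightarrow> 'v set" and V E \<F> R
begin

definition inactive :: "'v set set" where
  "inactive = {H \<in> \<F>. R H = {}}"

definition host :: "'v set \<Rightarrow> nat" where
  "host H = (SOME x. x < n \<and> H \<subseteq> \<Union>(edge_bag \<F> R x))"

definition active_edges :: "'v set set set" where
  "active_edges = {{H, G} | H G. H \<noteq> G \<and> (\<exists>x<n. H \<in> edge_bag \<F> R x \<and> G \<in> edge_bag \<F> R x)}"

definition support :: "'v set set set" where
  "support = active_edges \<union> leaf_edges (edge_bag \<F> R) host inactive"

lemma edge_bag_subset: "edge_bag \<F> R x \<subseteq> \<F> - inactive"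
  by (auto simp: edge_bag_def active_def inactive_def)

lemma inactive_subset: "inactive \<subseteq> \<F>"
  by (auto simp: inactive_def)

lemma active_lessThan: "H \<in> active \<F> R x \<Longrightarrow> x < n"
  using active_subset_occ by (auto simp: active_def occ_def)

lemma host_covers:
  assumes "H \<in> inactive"
  shows "host H < n" "H \<subseteq> \<Union>(edge_bag \<F> R (host H))"
proof -
  have "\<exists>x<n. H \<subseteq> \<Union>(edge_bag \<F> R x)"
    using assms inactive_covered[of H] nodes_nonempty by (cases "H = {}") (auto simp: inactive_def)
  then have "host H < n \<and> H \<subseteq> \<Union>(edge_bag \<F> R (host H))" unfolding host_def by (rule someI_ex)
  then show "host H < n" "H \<subseteq> \<Union>(edge_bag \<F> R (host H))" by blast+
qed

lemma rooted_decomposition_active: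
  "rooted_decomposition par n (edge_bag \<F> R) (\<F> - inactive) active_edges"
proof
  show "\<exists>x<n. H \<in> edge_bag \<F> R x" if H: "H \<in> \<F> - inactive" for H
  proof -
    obtain x where "x \<in> R H" using H by (auto simp: inactive_def)
    then have "H \<in> active \<F> R x" using H by (simp add: active_def)
    then show ?thesis using active_lessThan by (auto simp: edge_bag_def)
  qed
  show "subtree (occ n (edge_bag \<F> R) {H})" if "H \<in> \<F> - inactive" for H
  proof -
    have "occ n (edge_bag \<F> R) {H} = {x. x \<in> R H \<or> par x \<in> R H} \<inter> {..<n}"
      using that by (auto simp: occ_def edge_bag_def active_def)
    then show ?thesis
      using that by (simp add: subtree_Int subtree_with_children subtree_active subtree_lessThan)
  qed
qed (use nodes_nonempty edge_bag_subset in \<open>auto simp: active_edges_def\<close>)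

lemma card_edge_bag:
  assumes w: "\<And>k. k < n \<Longrightarrow> card (B k) \<le> w" and x: "x < n"
  shows "card (edge_bag \<F> R x) \<le> 2 * 2 ^ w"
proof -
  have card_active: "card (active \<F> R y) \<le> 2 ^ w" if "y < n" for y
  proof -
    have "card (active \<F> R y) \<le> card (Pow (B y))"
      using finite_bag[OF that] by (intro card_inj_on_le[OF inj_on_trace[OF that]]) auto
    also have "\<dots> \<le> 2 ^ w" using w[OF that] finite_bag[OF that] by (simp add: card_Pow power_increasing)
    finally show ?thesis .
  qed
  have "par x < n" using par_le[of x] x by simp
  have "card (edge_bag \<F> R x) \<le> card (active \<F> R x) + card (active \<F> R (par x))"
    by (simp add: edge_bag_def card_Un_le)
  then show ?thesis using card_active[OF x] card_active[OF \<open>par x < n\<close>] by simp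
qed

lemma treewidth_support:
  assumes "\<And>k. k < n \<Longrightarrow> card (B k) \<le> w"
  shows "treewidth \<F> support \<le> 2 * 2 ^ w"
proof -
  have "treewidth ((\<F> - inactive) \<union> inactive) support \<le> 2 * 2 ^ w"
    unfolding support_def
    using finite_subset[OF inactive_subset finite_family] host_covers(1) card_edge_bag[OF assms]
    by (intro rooted_decomposition.treewidth_add_leaves[OF rooted_decomposition_active]) auto
  then show ?thesis using inactive_subset by (simp add: Un_absorb2)
qed

lemma graph_support: "graph \<F> support"
  unfolding graph_def
proof (intro conjI ballI)
  fix e assume "e \<in> support"
  then consider H G x where "e = {H, G}" "H \<noteq> G" "H \<in> edge_bag \<F> R x" "G \<in> edge_bag \<F> R x"
    | H G where "e = {H, G}" "H \<in> inactive" "G \<in> edge_bag \<F> R (host H)"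
    by (auto simp: support_def active_edges_def leaf_edges_def)
  then show "\<exists>H G. H \<noteq> G \<and> H \<in> \<F> \<and> G \<in> \<F> \<and> e = {H, G}"
  proof cases
    case (1 H G x)
    then have "H \<in> \<F>" "G \<in> \<F>" using edge_bag_subset[of x] by auto
    then show ?thesis using 1 by blast
  next
    case (2 H G)
    then have "H \<in> \<F>" "G \<in> \<F>" "H \<noteq> G"
      using edge_bag_subset[of "host H"] inactive_subset by auto
    then show ?thesis using 2 by blast
  qed
qed (rule finite_family)

definition meeting :: "'v set \<Rightarrow> 'v set set" where
  "meeting K = {H \<in> \<F>. H \<inter> K \<noteq> {}}"

abbreviation linked :: "'v set \<Rightarrow> 'v set \<Rightarrow> 'v set \<Rightarrow> bool" where
  "linked K \<equiv> walk support (meeting K)"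

lemma meetingI: "H \<in> \<F> \<Longrightarrow> v \<in> H \<Longrightarrow> v \<in> K \<Longrightarrow> H \<in> meeting K"
  by (auto simp: meeting_def)

lemma linked_common_bag:
  assumes "H \<in> meeting K" "G \<in> meeting K" "x < n" "H \<in> edge_bag \<F> R x" "G \<in> edge_bag \<F> R x"
  shows "linked K H G"
proof (cases "H = G")
  case False
  then have "{H, G} \<in> support" using assms by (auto simp: support_def active_edges_def)
  then show ?thesis using assms by (intro r_into_rtranclp) simp
qed simp

lemma linked_active:
  assumes "H \<in> meeting K" "G \<in> meeting K" "H \<in> active \<F> R x" "G \<in> active \<F> R y" "x = y \<or> adjacent x y"
  shows "linked K H G"
proof -
  have "x < n" "y < n" using assms active_lessThan by blast+
  moreover have "(H \<in> edge_bag \<F> R x \<and> G \<in> edge_bag \<F> R x) \<or> (H \<in> edge_bag \<F> R y \<and> G \<in> edge_bag \<F> R y)"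
    using assms(3-5) by (auto simp: edge_bag_def adjacent_def)
  ultimately show ?thesis using linked_common_bag assms(1,2) by blast
qed

lemma linked_to_active_at:
  assumes H: "H \<in> active \<F> R j" and v: "v \<in> H" "v \<in> K" and p: "v \<in> B p" "p < n"
  shows "\<exists>G\<in>meeting K. G \<in> active \<F> R p \<and> linked K H G"
  using H v(1)
proof (induction "card (hull j p)" arbitrary: H j rule: less_induct)
  case less
  have HF: "H \<in> \<F>" "j \<in> R H" using less.prems(1) by (simp_all add: active_def)
  have H: "H \<in> meeting K" using meetingI HF less.prems v by blast
  show ?case
  proof (cases "p \<in> R H")
    case True
    then show ?thesis using H HF by (auto simp: active_def)
  next
    case False
    with HF(2) obtain x y where xy: "x \<in> R H" "y \<notin> R H" "adjacent x y" "p \<in> side x y"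
      and closer: "card (hull y p) < card (hull j p)"
      by (rule exit_edge)
    have "p \<in> occ n B H" "x \<in> occ n B H"
      using less.prems p xy(1) active_subset_occ[OF HF(1)] by (auto simp: occ_def)
    then have "y \<in> occ n B H"
      using subtree_crossing(2)[OF subtree_occ_member[OF HF(1)] xy(3)] xy(4) side_ends[OF xy(3)] by blast
    then obtain G where G: "G \<in> active \<F> R y" "occ n B (H - G) \<inter> side x y = {}"
      using boundary[OF HF(1) xy(3,1)] xy(2) by blast
    have "v \<in> G" using G(2) xy(4) p less.prems by (auto simp: occ_def)
    then obtain G' where G': "G' \<in> meeting K" "G' \<in> active \<F> R p" "linked K G G'"
      using less.hyps[OF closer G(1)] by blast
    have "G \<in> meeting K" using meetingI \<open>v \<in> G\<close> v G(1) by (auto simp: active_def)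
    then have "linked K H G"
      using linked_active[OF H _ _ G(1)] xy HF by (auto simp: active_def)
    then show ?thesis using G' rtranclp_trans[of _ H G G'] by blast
  qed
qed

lemma linked_to_active:
  assumes H: "H \<in> \<F>" "v \<in> H" "v \<in> K" and p: "v \<in> B p" "p < n"
  shows "\<exists>G\<in>meeting K. G \<in> active \<F> R p \<and> linked K H G"
proof (cases "R H = {}")
  case False
  then obtain j where "H \<in> active \<F> R j" using H by (auto simp: active_def)
  then show ?thesis using linked_to_active_at H p by blast
next
  case True
  then have inactive: "H \<in> inactive" using H by (simp add: inactive_def)
  then obtain A where A: "A \<in> edge_bag \<F> R (host H)" "v \<in> A" using host_covers H by blast
  then obtain j where j: "A \<in> active \<F> R j" by (auto simp: edge_bag_def)
  obtain G where G: "G \<in> meeting K" "G \<in> active \<F> R p" "linked K A G"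
    using linked_to_active_at[OF j A(2) H(3) p] by blast
  have "H \<in> meeting K" "A \<in> meeting K" using meetingI H A j by (auto simp: active_def)
  moreover have "{H, A} \<in> support" using inactive A by (auto simp: support_def leaf_edges_def)
  ultimately have "linked K H A" by (intro r_into_rtranclp) simp
  then show ?thesis using G rtranclp_trans[of _ H A G] by blast
qed

lemma linked_along_subtree:
  assumes N: "subtree N" "p \<in> N" "q \<in> N"
    and occupied: "\<And>x. x \<in> N \<Longrightarrow> \<exists>G\<in>meeting K. G \<in> active \<F> R x"
    and H: "H \<in> meeting K" "H \<in> active \<F> R p" and G: "G \<in> meeting K" "G \<in> active \<F> R q"
  shows "linked K H G"
proof -
  have "\<forall>G\<in>meeting K. G \<in> active \<F> R q \<longrightarrow> linked K H G"
  proof (rule subtree_induct[OF N])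
    show "\<forall>G\<in>meeting K. G \<in> active \<F> R p \<longrightarrow> linked K H G"
      using linked_active H by blast
  next
    fix x y
    assume x: "x \<in> N" and "adjacent x y"
      and IH: "\<forall>G\<in>meeting K. G \<in> active \<F> R x \<longrightarrow> linked K H G"
    obtain A where A: "A \<in> meeting K" "A \<in> active \<F> R x" using occupied[OF x] by blast
    show "\<forall>G\<in>meeting K. G \<in> active \<F> R y \<longrightarrow> linked K H G"
    proof (intro ballI impI)
      fix G assume "G \<in> meeting K" "G \<in> active \<F> R y"
      then have "linked K A G" using linked_active A \<open>adjacent x y\<close> by blast
      moreover have "linked K H A" using IH A by blast
      ultimately show "linked K H G" by (rule rtranclp_trans[rotated])
    qed
  qed
  then show ?thesis using G by blast
qed

lemma connected_set_meeting:
  assumes sub: "subtree (occ n B (K \<inter> \<Union>\<F>))"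
  shows "connected_set support (meeting K)"
  unfolding connected_set_def
proof (intro ballI)
  let ?N = "occ n B (K \<inter> \<Union>\<F>)"
  have start: "\<exists>p\<in>?N. \<exists>A\<in>meeting K. A \<in> active \<F> R p \<and> linked K H A" if H: "H \<in> meeting K" for H
  proof -
    obtain v where v: "H \<in> \<F>" "v \<in> H" "v \<in> K" using H by (auto simp: meeting_def)
    then obtain p where p: "p < n" "v \<in> B p" using vertex_in_bag member_subset by blast
    then have "p \<in> ?N" using v by (auto simp: occ_def)
    then show ?thesis using linked_to_active[OF v p(2,1)] by blast
  qed
  have occupied: "\<exists>A\<in>meeting K. A \<in> active \<F> R p" if p: "p \<in> ?N" for p
  proof -
    obtain v H where "H \<in> \<F>" "v \<in> H" "v \<in> K" "v \<in> B p" "p < n" using p by (auto simp: occ_def)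
    then show ?thesis using linked_to_active[of H v K p] by blast
  qed
  fix H G assume "H \<in> meeting K" "G \<in> meeting K"
  then obtain p A q C where p: "p \<in> ?N" "A \<in> meeting K" "A \<in> active \<F> R p" "linked K H A"
    and q: "q \<in> ?N" "C \<in> meeting K" "C \<in> active \<F> R q" "linked K G C"
    using start by meson
  have "linked K A C" by (rule linked_along_subtree[OF sub p(1) q(1) occupied p(2,3) q(2,3)])
  moreover have "linked K C G" using q(4) by (rule walk_sym)
  ultimately show "linked K H G" using p(4) by (meson rtranclp_trans)
qed

lemma intersection_support_support:
  assumes "\<And>K. K \<in> \<K> \<Longrightarrow> subtree (occ n B (K \<inter> \<Union>\<F>))"
  shows "intersection_support \<F> \<K> support"
  using graph_support connected_set_meeting[OF assms] by (simp add: intersection_support_def meeting_def)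

end

theorem mainTheorem3:
  fixes V :: "'a set" and E :: "'a set set" and \<H> \<K> :: "'a set set" and t :: nat
  assumes "graph V E"
    and "treewidth V E = t"
    and "non_piercing V E \<H>"
    and "non_piercing V E \<K>"
  shows "\<exists>Q. intersection_support \<H> \<K> Q \<and>
               treewidth \<H> Q \<le> 2 ^ (2 ^ (t + 4) + 4 * (t + 1))"
proof -
  let ?w = "(t + 1) + 2 * 2 ^ (t + 1)"
  have fin: "finite V" using assms(1) by (simp add: graph_def)
  obtain par n B where "rooted_decomposition par n B V E" and B: "\<And>k. k < n \<Longrightarrow> card (B k) \<le> t + 1"
    using exists_rooted_decomposition[OF assms(1)] assms(2) by metis
  then interpret nonpiercing_decomposition par n B V E \<K>
    using fin assms(4) by (simp add: nonpiercing_decomposition_def nonpiercing_decomposition_axioms_def)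
  obtain B' where "rooted_decomposition par n B' V E" and B': "\<And>k. k < n \<Longrightarrow> card (B' k) \<le> ?w"
    and gapless: "\<And>K. K \<in> \<K> \<Longrightarrow> subtree (occ n B' (K \<inter> \<Union>\<H>))"
    using exists_gapless_decomposition[OF B] by metis
  then interpret B': nonpiercing_decomposition par n B' V E \<H>
    using fin assms(3) by (simp add: nonpiercing_decomposition_def nonpiercing_decomposition_axioms_def)
  obtain R where "pruning par n B' V E \<H> n R" using B'.exists_pruning by blast
  then interpret complete_pruning par n B' V E \<H> R by (simp add: complete_pruning_def)
  have "treewidth \<H> support \<le> 2 * 2 ^ ?w" using treewidth_support B' by blast
  also have "\<dots> = 2 ^ Suc ?w" by simp
  also have "\<dots> \<le> 2 ^ (2 ^ (t + 4) + 4 * (t + 1))"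
    by (rule power_increasing) (simp_all add: power_add)
  finally show ?thesis using intersection_support_support[OF gapless] by blast
qed

end
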